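(* Let $P\subseteq\mathbb{R}^n$ be a rational polyhedron with vertices $\{v^i\}_{i\in V}$ and extreme rays $\{r^j\}_{j\in E}$, i.e. $P=\operatorname{conv}(\{v^i\}_{i\in V})+\operatorname{cone}(\{r^j\}_{j\in E})$. Let $L\subseteq\mathbb{R}^n$ be a full dimensional polyhedron whose recession cone $0^+(L)$ is a linear space. Then the set $$R(L,P):=\operatorname{conv}(\{x\in P:x\notin\operatorname{int}(L)\})$$ is a polyhedron.
   Context: $V$ and $E$ are finite index sets, $v^i\in\mathbb{Q}^n$ and $r^j\in\mathbb{Z}^n$. $\operatorname{int}(L)$ denotes the interior of $L$. *)

theory Defs
  imports "HOL-Analysis.Analysis"
begin

definition rational_vec :: "real ^ 'n \<Rightarrow> bool" where
  "rational_vec x \<longleftrightarrow> (\<forall>k. x $ k \<in> \<rat>)"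

definition integral_vec :: "real ^ 'n \<Rightarrow> bool" where
  "integral_vec x \<longleftrightarrow> (\<forall>k. x $ k \<in> \<int>)"

text \<open>A solution set of finitely many linear inequalities with rational data. The normal
  vector a is allowed to be zero, as for a general rational system \<open>A x \<le> b\<close>.\<close>

definition rational_polyhedron :: "(real ^ 'n) set \<Rightarrow> bool" where
  "rational_polyhedron P \<longleftrightarrow>
     (\<exists>F :: ((real ^ 'n) \<times> real) set. finite F \<and>
        (\<forall>(a, b) \<in> F. rational_vec a \<and> b \<in> \<rat>) \<and>
        P = {x. \<forall>(a, b) \<in> F. a \<bullet> x \<le> b})"

definition recession_cone :: "'a::real_vector set \<Rightarrow> 'a set" where
  "recession_cone C = {d. \<forall>x \<in> C. \<forall>t \<ge> 0. x + t *\<^sub>R d \<in> C}"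

text \<open>An extreme ray of P is a direction, taken as a half-line from the origin, that is a
  one-dimensional face of the recession cone of P. The library's \<open>convex_cone hull\<close> always
  contains 0 (unlike \<open>cone hull\<close>, which is empty on the empty set), so it is the usual cone
  operator, and \<open>convex_cone hull {d}\<close> is the set of nonnegative multiples of d.\<close>

definition extreme_ray_of :: "'a::real_vector set \<Rightarrow> 'a set \<Rightarrow> bool"
    (infixr \<open>(extreme'_ray'_of)\<close> 50) where
  "T extreme_ray_of P \<longleftrightarrow>
     T face_of recession_cone P \<and> (\<exists>d. d \<noteq> 0 \<and> T = convex_cone hull {d})"

definition R_hull :: "'a::euclidean_space set \<Rightarrow> 'a set \<Rightarrow> 'a set" where
  "R_hull L P = convex hull {x \<in> P. x \<notin> interior L}"

end

theory Submission
  imports Defs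
begin

text \<open>Let \<open>C\<close> be the recession cone of \<open>P\<close>. The complement of \<open>interior L\<close> is a finite union of
  closed half-spaces \<open>H\<close>, and each \<open>P \<inter> H\<close> lies in \<open>convex hull Q + C\<close> for some finite
  \<open>Q \<subseteq> P \<inter> H\<close>. The pieces \<open>P \<inter> H\<close> need not have the same recession cone, but \<open>R(L, P) + C\<close> lies
  in \<open>R(L, P)\<close>: as the recession cone of \<open>L\<close> is linear, a direction \<open>d \<in> C\<close> that points back
  towards \<open>L\<close> across one of its facets eventually leaves \<open>L\<close> across another one, so \<open>x + d\<close> lies
  on a segment between two points of \<open>P\<close> outside \<open>interior L\<close>. Hence \<open>R(L, P)\<close> is the sum of the
  convex hull of a finite set and the finitely generated cone \<open>C\<close>.\<close>

section \<open>Affine preimages of polyhedra and sections of finitely generated cones\<close>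

lemma polyhedron_affine_preimage:
  fixes f :: "'a::euclidean_space \<Rightarrow> 'b::euclidean_space"
  assumes "polyhedron T" "linear f"
  shows "polyhedron {x. f x + c \<in> T}"
proof -
  obtain F where "finite F" and T: "T = \<Inter>F"
    and F: "\<And>h. h \<in> F \<Longrightarrow> \<exists>a b. a \<noteq> 0 \<and> h = {y. a \<bullet> y \<le> b}"
    using assms(1) unfolding polyhedron_def by blast
  have "polyhedron {x. f x + c \<in> h}" if h: "h \<in> F" for h
  proof -
    obtain a b where "h = {y. a \<bullet> y \<le> b}"
      using F[OF h] by blast
    then have "{x. f x + c \<in> h} = {x. adjoint f a \<bullet> x \<le> b - a \<bullet> c}"
      using adjoint_clauses(2)[OF assms(2)] by (auto simp: inner_add_right algebra_simps)
    \<comment> \<open>The pulled-back normal \<open>adjoint f a\<close> may be zero;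
      \<open>polyhedron_halfspace_le\<close> covers that degenerate case too.\<close>
    then show ?thesis
      by (simp add: polyhedron_halfspace_le)
  qed
  then have "polyhedron (\<Inter>h\<in>F. {x. f x + c \<in> h})"
    using \<open>finite F\<close> by auto
  moreover have "{x. f x + c \<in> T} = (\<Inter>h\<in>F. {x. f x + c \<in> h})"
    by (auto simp: T)
  ultimately show ?thesis by simp
qed

text \<open>Apart from 0, the cone consists of the nonnegative multiples of the polytope
  \<open>convex hull S\<close>. A homogeneous half-space is invariant under positive scaling, so
  cutting the cone amounts to cutting the polytope, and a cut polytope has finitely many generators
  again.\<close>

lemma convex_cone_hull_Int_halfspace:
  fixes S :: "'a::euclidean_space set"
  assumes "finite S"
  obtains S' where "finite S'" "convex_cone hull S \<inter> {x. a \<bullet> x \<ge> 0} = convex_cone hull S'"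
proof -
  have "polytope (convex hull S \<inter> {x. a \<bullet> x \<ge> 0})"
    using assms by (intro polytope_Int_polyhedron polytope_convex_hull polyhedron_halfspace_ge)
  then obtain S' where S': "finite S'" "convex hull S \<inter> {x. a \<bullet> x \<ge> 0} = convex hull S'"
    unfolding polytope_def by blast
  have "x \<in> convex_cone hull S \<and> a \<bullet> x \<ge> 0 \<longleftrightarrow> x \<in> convex_cone hull S'" (is "?l \<longleftrightarrow> ?r") for x
  proof
    assume ?l
    show ?r
    proof (cases "x = 0")
      case False
      then obtain y c where y: "y \<in> convex hull S" "c \<ge> 0" "x = c *\<^sub>R y"
        using \<open>?l\<close> unfolding convex_cone_hull_convex_hull by auto
      with False have "c > 0" by (cases "c = 0") auto
      with \<open>?l\<close> y have "a \<bullet> y \<ge> 0" by (auto simp: zero_le_mult_iff)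
      then have "y \<in> convex hull S'" using y S' by blast
      then show ?r using y by (auto simp: convex_cone_hull_convex_hull)
    qed (simp add: convex_cone_hull_contains_0)
  next
    assume ?r
    then have "x = 0 \<or> (\<exists>y\<in>convex hull S'. \<exists>c\<ge>0. x = c *\<^sub>R y)"
      by (auto simp: convex_cone_hull_convex_hull)
    then show ?l
      unfolding S'(2)[symmetric] by (auto simp: convex_cone_hull_convex_hull)
  qed
  then have "convex_cone hull S \<inter> {x. a \<bullet> x \<ge> 0} = convex_cone hull S'"
    by auto
  with S'(1) show ?thesis by (rule that)
qed

section \<open>Homogenization of a convex hull plus a cone\<close>

text \<open>The homogenization of \<open>A + C\<close>, with the height as last coordinate: the
  slice at height 1 is \<open>A + C\<close> and, for nonempty \<open>A\<close>, the slice at height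
  0 is \<open>C\<close>. For empty \<open>A\<close> it is empty, hence not a cone.\<close>

definition cone_over :: "'a::real_vector set \<Rightarrow> 'a set \<Rightarrow> ('a \<times> real) set" where
  "cone_over A C = {(s *\<^sub>R q + c, s) | s q c. s \<ge> 0 \<and> q \<in> A \<and> c \<in> C}"

lemma cone_over_1: "(x, 1) \<in> cone_over A C \<longleftrightarrow> x \<in> A + C"
  by (auto simp: cone_over_def set_plus_def)

lemma cone_over_0: "A \<noteq> {} \<Longrightarrow> (x, 0) \<in> cone_over A C \<longleftrightarrow> x \<in> C"
  by (auto simp: cone_over_def)

lemma convex_cone_cone_over:
  assumes "convex A" "A \<noteq> {}" "convex_cone C"
  shows "convex_cone (cone_over A C)"
  unfolding convex_cone_iff
proof (intro conjI ballI allI impI)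
  show "0 \<in> cone_over A C"
    using assms by (auto simp: zero_prod_def cone_over_0 convex_cone_contains_0)
next
  fix x k assume "x \<in> cone_over A C" "(k::real) \<ge> 0"
  then obtain s q c where x: "x = (s *\<^sub>R q + c, s)" "s \<ge> 0" "q \<in> A" "c \<in> C"
    unfolding cone_over_def by blast
  have "k *\<^sub>R x = ((k * s) *\<^sub>R q + k *\<^sub>R c, k * s)"
    by (simp add: x scaleR_add_right)
  moreover have "k *\<^sub>R c \<in> C" "k * s \<ge> 0"
    using assms(3) x \<open>k \<ge> 0\<close> by (auto simp: convex_cone_scaleR)
  ultimately show "k *\<^sub>R x \<in> cone_over A C"
    unfolding cone_over_def using x by blast
next
  fix x y assume "x \<in> cone_over A C" "y \<in> cone_over A C"
  then obtain s q c t p d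
    where x: "x = (s *\<^sub>R q + c, s)" "s \<ge> 0" "q \<in> A" "c \<in> C"
      and y: "y = (t *\<^sub>R p + d, t)" "t \<ge> 0" "p \<in> A" "d \<in> C"
    unfolding cone_over_def by blast
  \<comment> \<open>The point \<open>w\<close> is the mean of \<open>q\<close> and \<open>p\<close>
    with weights proportional to \<open>s\<close> and \<open>t\<close>; when both are 0, any point
    of \<open>A\<close> serves.\<close>
  have "\<exists>w\<in>A. s *\<^sub>R q + t *\<^sub>R p = (s + t) *\<^sub>R w"
  proof (cases "s + t = 0")
    case True
    then have "s = 0" "t = 0" using x(2) y(2) by linarith+
    then show ?thesis using x(3) by auto
  next
    case False
    then have "s + t > 0" using x y by linarith
    then have "(s / (s+t)) *\<^sub>R q + (t / (s+t)) *\<^sub>R p \<in> A"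
      using x y by (intro convexD[OF assms(1)]) (auto simp: add_divide_distrib[symmetric])
    then show ?thesis using False by (intro bexI) (auto simp: scaleR_add_right)
  qed
  then obtain w where "w \<in> A" "s *\<^sub>R q + t *\<^sub>R p = (s + t) *\<^sub>R w" by blast
  then have "x + y = ((s + t) *\<^sub>R w + (c + d), s + t)"
    by (simp add: x y algebra_simps)
  moreover have "c + d \<in> C" using assms(3) x y by (simp add: convex_cone_add)
  ultimately show "x + y \<in> cone_over A C"
    unfolding cone_over_def using x y \<open>w \<in> A\<close> by (blast intro: add_nonneg_nonneg)
qed

text \<open>Points of \<open>V\<close> enter at height 1 and directions of \<open>E\<close> at
  height 0. Thus finite \<open>V\<close> and \<open>E\<close> give a finitely generated cone, to
  which results on such cones apply.\<close>

lemma cone_over_hulls: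
  assumes "V \<noteq> {}"
  shows "cone_over (convex hull V) (convex_cone hull E) =
    convex_cone hull ((\<lambda>v. (v, 1)) ` V \<union> (\<lambda>e. (e, 0)) ` E)" (is "?L = convex_cone hull ?S")
proof
  show "convex_cone hull ?S \<subseteq> ?L"
  proof (rule hull_minimal)
    show "convex_cone ?L"
      using assms by (simp add: convex_cone_cone_over convex_cone_convex_cone_hull)
    have "(v, 1) \<in> ?L" if "v \<in> V" for v
      using set_plus_intro[OF hull_inc[OF that] convex_cone_hull_contains_0[of E], of convex]
      by (simp add: cone_over_1)
    moreover have "(e, 0) \<in> ?L" if "e \<in> E" for e
      using assms that by (simp add: cone_over_0 hull_inc)
    ultimately show "?S \<subseteq> ?L" by auto
  qed
next
  have K: "convex_cone (convex_cone hull ?S)"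
    by (rule convex_cone_convex_cone_hull)
  \<comment> \<open>The slice of a convex set at height 1 is convex, and this one contains
    \<open>V\<close>.\<close>
  have 1: "(q, 1) \<in> convex_cone hull ?S" if "q \<in> convex hull V" for q
  proof -
    have "convex {q. (q, 1::real) \<in> convex_cone hull ?S}"
    proof (rule convexI)
      fix x y and u w :: real
      assume "x \<in> {q. (q, 1::real) \<in> convex_cone hull ?S}"
        "y \<in> {q. (q, 1::real) \<in> convex_cone hull ?S}" and uw: "0 \<le> u" "0 \<le> w" "u + w = 1"
      then have "u *\<^sub>R (x, 1) + w *\<^sub>R (y, 1) \<in> convex_cone hull ?S"
        by (intro convexD[OF convex_convex_cone_hull]) auto
      then show "u *\<^sub>R x + w *\<^sub>R y \<in> {q. (q, 1::real) \<in> convex_cone hull ?S}"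
        using uw by simp
    qed
    then have "convex hull V \<subseteq> {q. (q, 1) \<in> convex_cone hull ?S}"
      by (intro hull_minimal) (auto intro: hull_inc)
    then show ?thesis using that by blast
  qed
  have 0: "(c, 0) \<in> convex_cone hull ?S" if "c \<in> convex_cone hull E" for c
  proof -
    have "convex_cone hull ((\<lambda>e. (e, 0::real)) ` E) = (\<lambda>e. (e, 0)) ` (convex_cone hull E)"
      by (intro convex_cone_hull_linear_image) (auto intro!: linearI)
    then have "(c, 0) \<in> convex_cone hull ((\<lambda>e. (e, 0::real)) ` E)"
      using that by blast
    then show ?thesis using hull_mono[of "(\<lambda>e. (e, 0)) ` E" ?S convex_cone] by blast
  qed
  have "s *\<^sub>R (q, 1) + (c, 0) \<in> convex_cone hull ?S"
    if "s \<ge> 0" "q \<in> convex hull V" "c \<in> convex_cone hull E" for s q c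
    using that K 0 1 by (intro convex_cone_add convex_cone_scaleR) auto
  then show "?L \<subseteq> convex_cone hull ?S"
    by (auto simp: cone_over_def)
qed

text \<open>One direction of the Minkowski-Weyl theorem: the homogenization is a finitely generated
  cone, hence a polyhedron, and its slice at height 1 is an affine preimage of it.\<close>

lemma polyhedron_convex_hull_plus_cone:
  fixes V E :: "'a::euclidean_space set"
  assumes "finite V" "finite E"
  shows "polyhedron (convex hull V + convex_cone hull E)"
proof (cases "V = {}")
  case True
  then show ?thesis by (simp add: set_plus_def)
next
  case False
  have "polyhedron (cone_over (convex hull V) (convex_cone hull E))"
    unfolding cone_over_hulls[OF False] using assms by (intro polyhedron_convex_cone_hull) auto
  then have "polyhedron {x. (x, 0) + (0, 1) \<in> cone_over (convex hull V) (convex_cone hull E)}"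
    by (rule polyhedron_affine_preimage) (auto intro!: linearI)
  then show ?thesis by (simp add: cone_over_1)
qed

text \<open>The inequality \<open>a \<bullet> x \<ge> b\<close> homogenizes to
  \<open>(a, - b) \<bullet> (x, s) \<ge> 0\<close>, which cuts the homogenization in a finitely
  generated cone. Generators of positive height, rescaled to height 1, form \<open>Q\<close>; those
  of height 0 lie in the cone of \<open>E\<close>. The last claim is an inclusion because the
  section may have fewer recession directions than \<open>P\<close>.\<close>

lemma convex_hull_plus_cone_Int_halfspace:
  fixes V E :: "'a::euclidean_space set"
  defines "P \<equiv> convex hull V + convex_cone hull E"
  assumes "finite V" "finite E"
  obtains Q where "finite Q" "Q \<subseteq> P \<inter> {x. a \<bullet> x \<ge> b}"
    "P \<inter> {x. a \<bullet> x \<ge> b} \<subseteq> convex hull Q + convex_cone hull E"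
proof (cases "V = {}")
  case True
  then show ?thesis using that[of "{}"] by (simp add: P_def set_plus_def)
next
  case False
  let ?C = "convex_cone hull E"
  let ?K = "cone_over (convex hull V) ?C"
  have K: "conic ?K"
    using False convex_cone_cone_over[OF convex_convex_hull _ convex_cone_convex_cone_hull]
    unfolding convex_cone_def by auto
  obtain S' where S': "finite S'" and eq: "?K \<inter> {z. (a, - b) \<bullet> z \<ge> 0} = convex_cone hull S'"
    using convex_cone_hull_Int_halfspace[of "(\<lambda>v. (v, 1::real)) ` V \<union> (\<lambda>e. (e, 0)) ` E" "(a, - b)"]
      assms(2,3) unfolding cone_over_hulls[OF False] by auto
  have S'K: "(x, s) \<in> ?K" "a \<bullet> x \<ge> b * s" "s \<ge> 0" if "(x, s) \<in> S'" for x s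
    using hull_inc[OF that, of convex_cone] unfolding eq[symmetric] by (auto simp: cone_over_def)
  define Q where "Q = (\<lambda>(x, s). (1 / s) *\<^sub>R x) ` {z \<in> S'. snd z > 0}"
  have memP: "(x, 1) \<in> convex_cone hull S'" if "x \<in> P \<inter> {x. a \<bullet> x \<ge> b}" for x
    using that unfolding eq[symmetric] by (auto simp: cone_over_1 P_def)
  have fin: "finite Q"
    using S' by (simp add: Q_def)
  have sub: "Q \<subseteq> P \<inter> {x. a \<bullet> x \<ge> b}"
  proof
    fix y assume "y \<in> Q"
    then obtain x s where y: "(x, s) \<in> S'" "s > 0" "y = (1 / s) *\<^sub>R x"
      by (auto simp: Q_def)
    have "(1 / s) *\<^sub>R (x, s) \<in> ?K"
      using y S'K by (intro conicD[OF K]) auto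
    then have "y \<in> P"
      using y by (simp add: cone_over_1 P_def)
    then show "y \<in> P \<inter> {x. a \<bullet> x \<ge> b}"
      using y S'K[OF y(1)] by (simp add: field_simps)
  qed
  have "P \<inter> {x. a \<bullet> x \<ge> b} \<subseteq> convex hull Q + ?C"
  proof (cases "Q = {}")
    \<comment> \<open>All generators then have height 0, so the cut cone has no point at height 1
      and the section of \<open>P\<close> is empty.\<close>
    case True
    have "S' \<subseteq> {z. snd z = 0}"
      using True S'K(3) by (force simp: Q_def)
    moreover have "convex_cone {z :: 'a \<times> real. snd z = 0}"
      by (simp add: convex_cone_iff)
    ultimately have "convex_cone hull S' \<subseteq> {z. snd z = 0}"
      by (rule hull_minimal)
    then show ?thesis
      using memP by force
  next
    case QV: False
    have "convex_cone hull S' \<subseteq> cone_over (convex hull Q) ?C"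
    proof (rule hull_minimal)
      show "convex_cone (cone_over (convex hull Q) ?C)"
        using QV by (simp add: convex_cone_cone_over convex_cone_convex_cone_hull)
      show "S' \<subseteq> cone_over (convex hull Q) ?C"
      proof clarify
        fix x s assume xs: "(x, s) \<in> S'"
        show "(x, s) \<in> cone_over (convex hull Q) ?C"
        proof (cases "s = 0")
          case True
          then show ?thesis
            using S'K(1)[OF xs] False QV by (simp add: cone_over_0)
        next
          case s: False
          then have "s > 0" using S'K(3)[OF xs] by simp
          then have "(1 / s) *\<^sub>R x \<in> convex hull Q"
            using xs by (intro hull_inc) (force simp: Q_def)
          moreover have "(x, s) = (s *\<^sub>R ((1 / s) *\<^sub>R x) + 0, s)"
            using s by simp
          ultimately show ?thesis
            unfolding cone_over_def using \<open>s > 0\<close> convex_cone_hull_contains_0[of E]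
            by (smt (verit) mem_Collect_eq)
        qed
      qed
    qed
    then show ?thesis
      using memP cone_over_1 by blast
  qed
  with fin sub show ?thesis by (rule that)
qed

section \<open>Leaving \<open>L\<close> along recession directions of \<open>P\<close>\<close>

lemma interior_Inter_halfspaces_le:
  fixes a :: "'i \<Rightarrow> 'a::euclidean_space"
  assumes "finite I" "\<And>i. i \<in> I \<Longrightarrow> a i \<noteq> 0"
  shows "interior (\<Inter>i\<in>I. {x. a i \<bullet> x \<le> b i}) = (\<Inter>i\<in>I. {x. a i \<bullet> x < b i})"
proof
  show "interior (\<Inter>i\<in>I. {x. a i \<bullet> x \<le> b i}) \<subseteq> (\<Inter>i\<in>I. {x. a i \<bullet> x < b i})"
  proof (rule INT_greatest)
    fix i assume "i \<in> I"
    then have "interior (\<Inter>i\<in>I. {x. a i \<bullet> x \<le> b i}) \<subseteq> interior {x. a i \<bullet> x \<le> b i}"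
      by (intro interior_mono) auto
    then show "interior (\<Inter>i\<in>I. {x. a i \<bullet> x \<le> b i}) \<subseteq> {x. a i \<bullet> x < b i}"
      using assms(2)[OF \<open>i \<in> I\<close>] by (simp add: interior_halfspace_le)
  qed
  show "(\<Inter>i\<in>I. {x. a i \<bullet> x < b i}) \<subseteq> interior (\<Inter>i\<in>I. {x. a i \<bullet> x \<le> b i})"
    using assms(1)
    by (intro interior_maximal open_INT) (auto simp: open_halfspace_lt intro: less_imp_le)
qed

text \<open>If no constraint increased along \<open>d\<close>, then \<open>d\<close> would be a
  recession direction of \<open>L\<close>, and by linearity so would \<open>- d\<close>. But
  constraint \<open>i\<close> increases without bound along \<open>- d\<close>.\<close>

lemma inner_pos_of_inner_neg:
  fixes a :: "'i \<Rightarrow> 'a::real_inner" and b :: "'i \<Rightarrow> real" and I :: "'i set"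
  defines "L \<equiv> \<Inter>i\<in>I. {x. a i \<bullet> x \<le> b i}"
  assumes "L \<noteq> {}" "subspace (recession_cone L)" "i \<in> I" "a i \<bullet> d < 0"
  shows "\<exists>j\<in>I. a j \<bullet> d > 0"
proof (rule ccontr)
  assume "\<not> ?thesis"
  then have le: "a j \<bullet> d \<le> 0" if "j \<in> I" for j using that by force
  have "d \<in> recession_cone L"
    unfolding recession_cone_def
  proof (clarsimp simp: L_def inner_add_right)
    fix x and t :: real and j
    assume x: "\<forall>i\<in>I. a i \<bullet> x \<le> b i" and "t \<ge> 0" "j \<in> I"
    then have "t * (a j \<bullet> d) \<le> 0" using le by (simp add: mult_nonneg_nonpos)
    with x \<open>j \<in> I\<close> show "a j \<bullet> x + t * (a j \<bullet> d) \<le> b j" by fastforce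
  qed
  then have "- d \<in> recession_cone L"
    using assms(3) by (rule subspace_neg[rotated])
  moreover obtain x where "x \<in> L" using assms(2) by blast
  ultimately have "x + t *\<^sub>R (- d) \<in> L" if "t \<ge> 0" for t
    using that unfolding recession_cone_def by blast
  then have le_b: "a i \<bullet> x - t * (a i \<bullet> d) \<le> b i" if "t \<ge> 0" for t
    using that assms(4) by (auto simp: L_def inner_diff_right)
  \<comment> \<open>With this \<open>t\<close>, the point \<open>x - t *\<^sub>R d\<close> has value
    \<open>b i + 1\<close> under \<open>a i\<close>.\<close>
  define t where "t = (b i - a i \<bullet> x + 1) / (- (a i \<bullet> d))"
  have "a i \<bullet> x \<le> b i" using le_b[of 0] by simp
  then have "t \<ge> 0" using assms(5) unfolding t_def by (intro divide_nonneg_pos) auto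
  moreover have "t * (a i \<bullet> d) = - (b i - a i \<bullet> x + 1)"
    using assms(5) by (simp add: t_def)
  ultimately show False using le_b[of t] by simp
qed

text \<open>The points that translation by \<open>d\<close> carries into the hull form a convex set,
  so it suffices to translate the points of \<open>P\<close> outside
  \<open>interior L\<close>.\<close>

lemma R_hull_plus_recession:
  fixes a :: "'i \<Rightarrow> 'a::euclidean_space" and b :: "'i \<Rightarrow> real" and I :: "'i set"
  defines "L \<equiv> \<Inter>i\<in>I. {x. a i \<bullet> x \<le> b i}"
  assumes "finite I" "\<And>i. i \<in> I \<Longrightarrow> a i \<noteq> 0" "L \<noteq> {}" "subspace (recession_cone L)"
    and "d \<in> recession_cone P" "x \<in> R_hull L P"
  shows "x + d \<in> R_hull L P"
proof -
  let ?S = "{x \<in> P. x \<notin> interior L}"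
  have int: "x \<notin> interior L \<longleftrightarrow> (\<exists>i\<in>I. a i \<bullet> x \<ge> b i)" for x
    unfolding L_def using assms(2,3) by (subst interior_Inter_halfspaces_le) (auto simp: not_less)
  have P: "x + t *\<^sub>R d \<in> P" if "x \<in> P" "t \<ge> 0" for x t
    using that assms(6) by (auto simp: recession_cone_def)
  have "?S \<subseteq> {x. x + d \<in> convex hull ?S}"
  proof clarify
    fix x assume x: "x \<in> P" "x \<notin> interior L"
    then obtain i where i: "i \<in> I" "a i \<bullet> x \<ge> b i" by (auto simp: int)
    show "x + d \<in> convex hull ?S"
    proof (cases "a i \<bullet> d < 0")
      case False
      then have "x + d \<in> ?S"
        using i P[OF x(1), of 1] by (auto simp: int inner_add_right intro!: bexI[of _ i])
      then show ?thesis by (rule hull_inc)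
    next
      case True
      then obtain j where j: "j \<in> I" "a j \<bullet> d > 0"
        using inner_pos_of_inner_neg[OF _ _ i(1)] assms(4,5) unfolding L_def by blast
      \<comment> \<open>The second term makes \<open>x + t *\<^sub>R d\<close> reach the bounding
        hyperplane of constraint \<open>j\<close>; the 1 keeps \<open>x + d\<close> on the segment
        from \<open>x\<close> to that point, where it has weight \<open>1/t\<close>.\<close>
      define t where "t = max 1 ((b j - a j \<bullet> x) / (a j \<bullet> d))"
      have t: "t \<ge> 1" by (simp add: t_def)
      have "(b j - a j \<bullet> x) / (a j \<bullet> d) \<le> t" by (simp add: t_def)
      then have "b j - a j \<bullet> x \<le> t * (a j \<bullet> d)" using j(2) by (simp add: field_simps)
      then have "x + t *\<^sub>R d \<in> ?S"
        using j(1) t P[OF x(1), of t] by (auto simp: int inner_add_right intro!: bexI[of _ j])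
      moreover have "x \<in> ?S" using x by simp
      ultimately have "(1 - 1/t) *\<^sub>R x + (1/t) *\<^sub>R (x + t *\<^sub>R d) \<in> convex hull ?S"
        using t by (intro convexD[OF convex_convex_hull]) (auto intro: hull_inc)
      moreover have "(1 - 1/t) *\<^sub>R x + (1/t) *\<^sub>R (x + t *\<^sub>R d) = x + d"
        using t by (simp add: algebra_simps)
      ultimately show ?thesis by simp
    qed
  qed
  moreover have "convex {x. x + d \<in> convex hull ?S}"
  proof -
    have "{x. x + d \<in> convex hull ?S} = (+) (- d) ` (convex hull ?S)"
      by (force simp: image_iff algebra_simps)
    then show ?thesis by (simp add: convex_translation)
  qed
  ultimately have "convex hull ?S \<subseteq> {x. x + d \<in> convex hull ?S}"
    by (rule hull_minimal)
  then show ?thesis using assms(7) by (auto simp: R_hull_def)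
qed

section \<open>Finite generation of \<open>R_hull L P\<close>\<close>

lemma polyhedron_R_hull:
  fixes V E :: "'a::euclidean_space set"
  defines "P \<equiv> convex hull V + convex_cone hull E"
  assumes "finite V" "finite E" "polyhedron L" "L \<noteq> {}" "subspace (recession_cone L)"
  shows "polyhedron (R_hull L P)"
proof -
  let ?C = "convex_cone hull E"
  obtain F where F: "finite F" and L: "L = \<Inter>F"
    and "\<forall>h\<in>F. \<exists>a b. a \<noteq> 0 \<and> h = {x. a \<bullet> x \<le> b}"
    using assms(4) unfolding polyhedron_def by blast
  then obtain a b where ab: "\<And>h. h \<in> F \<Longrightarrow> a h \<noteq> 0 \<and> h = {x. a h \<bullet> x \<le> b h}"
    by metis
  then have Leq: "L = (\<Inter>h\<in>F. {x. a h \<bullet> x \<le> b h})"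
    unfolding L by blast
  have int: "x \<notin> interior L \<longleftrightarrow> (\<exists>h\<in>F. a h \<bullet> x \<ge> b h)" for x
    unfolding Leq using F ab by (subst interior_Inter_halfspaces_le) (auto simp: not_less)
  have C: "d \<in> recession_cone P" if "d \<in> ?C" for d
    unfolding recession_cone_def
  proof (intro CollectI ballI allI impI)
    fix x and t :: real assume "x \<in> P" "t \<ge> 0"
    then obtain q c where "x = q + c" "q \<in> convex hull V" "c \<in> ?C"
      by (auto simp: P_def elim: set_plus_elim)
    moreover have "c + t *\<^sub>R d \<in> ?C"
      using \<open>c \<in> ?C\<close> \<open>t \<ge> 0\<close> that by (intro convex_cone_hull_add convex_cone_hull_mul) auto
    ultimately show "x + t *\<^sub>R d \<in> P"
      by (simp add: P_def add.assoc set_plus_intro)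
  qed
  have "\<forall>h\<in>F. \<exists>Q. finite Q \<and> Q \<subseteq> P \<inter> {x. a h \<bullet> x \<ge> b h} \<and>
      P \<inter> {x. a h \<bullet> x \<ge> b h} \<subseteq> convex hull Q + ?C"
    using convex_hull_plus_cone_Int_halfspace[OF assms(2,3)] unfolding P_def by metis
  then obtain Q where Q: "\<And>h. h \<in> F \<Longrightarrow> finite (Q h) \<and> Q h \<subseteq> P \<inter> {x. a h \<bullet> x \<ge> b h} \<and>
      P \<inter> {x. a h \<bullet> x \<ge> b h} \<subseteq> convex hull Q h + ?C"
    by metis
  let ?Q = "\<Union>h\<in>F. Q h"
  have "R_hull L P = convex hull ?Q + ?C"
  proof
    show "R_hull L P \<subseteq> convex hull ?Q + ?C"
      unfolding R_hull_def
    proof (rule hull_minimal)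
      show "convex (convex hull ?Q + ?C)"
        by (intro convex_set_plus convex_convex_hull convex_convex_cone_hull)
      show "{x \<in> P. x \<notin> interior L} \<subseteq> convex hull ?Q + ?C"
      proof clarify
        fix x assume "x \<in> P" "x \<notin> interior L"
        then obtain h where "h \<in> F" "x \<in> convex hull Q h + ?C"
          using Q by (force simp: int)
        \<comment> \<open>All pieces share the cone \<open>?C\<close>, so they fit into one sum over
          the union of the sets \<open>Q h\<close>.\<close>
        moreover have "convex hull Q h + ?C \<subseteq> convex hull ?Q + ?C"
          using \<open>h \<in> F\<close> by (intro set_plus_mono2 hull_mono) auto
        ultimately show "x \<in> convex hull ?Q + ?C" by blast
      qed
    qed
    have "convex hull ?Q \<subseteq> R_hull L P"
      unfolding R_hull_def
    proof (rule hull_mono)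
      show "?Q \<subseteq> {x \<in> P. x \<notin> interior L}"
        using Q unfolding int by blast
    qed
    \<comment> \<open>Each element of \<open>?C\<close> is a recession direction of
      \<open>P\<close>, so adding it does not leave \<open>R_hull L P\<close>.\<close>
    then show "convex hull ?Q + ?C \<subseteq> R_hull L P"
      using R_hull_plus_recession[of F a b _ P] F ab C assms(5,6) unfolding Leq
      by (auto elim!: set_plus_elim)
  qed
  moreover have "finite ?Q" using F Q by blast
  ultimately show ?thesis
    using assms(3) by (simp add: polyhedron_convex_hull_plus_cone)
qed

theorem lemma2p4:
  fixes P L :: "(real ^ 'n) set"
    and V :: "'i set" and v :: "'i \<Rightarrow> real ^ 'n"
    and E :: "'j set" and r :: "'j \<Rightarrow> real ^ 'n"
  assumes "finite V" and "finite E"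
    and "\<And>i. i \<in> V \<Longrightarrow> rational_vec (v i)"
    and "\<And>j. j \<in> E \<Longrightarrow> integral_vec (r j)"
    and "rational_polyhedron P"
    and vertices: "v ` V = {x. x extreme_point_of P}"
    and extreme_rays: "(\<lambda>j. convex_cone hull {r j}) ` E = {T. T extreme_ray_of P}"
    and P_eq: "P = convex hull (v ` V) + convex_cone hull (r ` E)"
    and "polyhedron L"
    and full_dim: "aff_dim L = int CARD('n)"
    and "subspace (recession_cone L)"
  shows "polyhedron (R_hull L P)"
proof -
  \<comment> \<open>The empty set has affine dimension -1.\<close>
  have "L \<noteq> {}"
    using full_dim by auto
  then show ?thesis
    unfolding P_eq using assms(1,2,9,11) by (intro polyhedron_R_hull) auto
qed

end
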